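(* Let $R' \colon \mathbb{P} \to \mathbb{N}$ be a map. Suppose that there exists a $k \in \mathbb{N}_{>0}$ such that for all but finitely many $p \in \mathbb{P}$, $R'(p)$ is a modular inverse modulo $p$ of some power $R$ of $2$ (depending on $p$) with $2^{-k} R \leq p < R$ (that is, $R'(p) R \equiv 1 \pmod{p}$). Then the image of $R'$ in $\mathcal{A}$ is transcendental over $\mathbb{Q}$.
   Context: $\mathbb{N}$ is the set of non-negative integers, $\mathbb{P}$ is the set of prime numbers, and $\mathbb{F}_p = \mathbb{Z}/p\mathbb{Z}$. Set $\mathcal{A} := \prod_{p \in \mathbb{P}} \mathbb{F}_p \big/ \bigoplus_{p \in \mathbb{P}} \mathbb{F}_p$, which is a $\mathbb{Q}$-algebra (every nonzero integer is invertible modulo all but finitely many primes). For a map $a \colon \mathbb{P} \to \mathbb{N}$, the image of $a$ in $\mathcal{A}$ is the class of $(a(p) + p\mathbb{Z})_{p \in \mathbb{P}}$. An element $\alpha \in \mathcal{A}$ is transcendental over $\mathbb{Q}$ if there is no $F \in \mathbb{Q}[x] \setminus \{0\}$ with $F(\alpha) = 0$ in $\mathcal{A}$. *)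

theory Defs
  imports
    "HOL-Number_Theory.Residues"
    "HOL-Algebra.QuotRing"
    "HOL-Computational_Algebra.Polynomial"
begin

definition ring_product :: "'i set \<Rightarrow> ('i \<Rightarrow> ('a, 'b) ring_scheme) \<Rightarrow> ('i \<Rightarrow> 'a) ring"
  where "ring_product I R =
    \<lparr>carrier = (\<Pi>\<^sub>E i\<in>I. carrier (R i)),
     monoid.mult = (\<lambda>x y. \<lambda>i\<in>I. x i \<otimes>\<^bsub>R i\<^esub> y i),
     one = (\<lambda>i\<in>I. \<one>\<^bsub>R i\<^esub>),
     zero = (\<lambda>i\<in>I. \<zero>\<^bsub>R i\<^esub>),
     add = (\<lambda>x y. \<lambda>i\<in>I. x i \<oplus>\<^bsub>R i\<^esub> y i)\<rparr>"

definition ring_direct_sum :: "'i set \<Rightarrow> ('i \<Rightarrow> ('a, 'b) ring_scheme) \<Rightarrow> ('i \<Rightarrow> 'a) set"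
  where "ring_direct_sum I R =
    {x \<in> \<Pi>\<^sub>E i\<in>I. carrier (R i). finite {i \<in> I. x i \<noteq> \<zero>\<^bsub>R i\<^esub>}}"

abbreviation primes :: "nat set" where "primes \<equiv> {p. prime p}"

definition prime_fields_product :: "(nat \<Rightarrow> int) ring"
  where "prime_fields_product = ring_product primes (\<lambda>p. residue_ring (int p))"

definition prime_fields_sum :: "(nat \<Rightarrow> int) set"
  where "prime_fields_sum = ring_direct_sum primes (\<lambda>p. residue_ring (int p))"

definition ring_A :: "(nat \<Rightarrow> int) set ring" (\<open>\<A>\<close>)
  where "\<A> = prime_fields_product Quot prime_fields_sum"

text \<open>Only the values of \<open>a\<close> at the primes matter. The residue field of \<open>p\<close> has carrier
  \<open>{0..p - 1}\<close>, so \<open>a p mod p\<close> represents the residue class of \<open>a p\<close>.\<close>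

definition image_A :: "(nat \<Rightarrow> int) \<Rightarrow> (nat \<Rightarrow> int) set"
  where "image_A a = prime_fields_sum +>\<^bsub>prime_fields_product\<^esub> (\<lambda>p\<in>primes. a p mod int p)"

text \<open>The structure map from the rationals sends \<open>m / n\<close> to \<open>(m \<cdot> 1) (n \<cdot> 1)\<^sup>-\<^sup>1\<close>.
  The inverse exists in \<open>\<A>\<close>, and the map is a ring homomorphism; see
  \<open>ring_A_int_Units\<close> and \<open>rat_A_hom\<close> below.\<close>

definition rat_A :: "rat \<Rightarrow> (nat \<Rightarrow> int) set"
  where "rat_A q =
    (case quotient_of q of (m, n) \<Rightarrow> [m] \<cdot>\<^bsub>\<A>\<^esub> \<one>\<^bsub>\<A>\<^esub> \<otimes>\<^bsub>\<A>\<^esub> inv\<^bsub>\<A>\<^esub> ([n] \<cdot>\<^bsub>\<A>\<^esub> \<one>\<^bsub>\<A>\<^esub>))"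

definition eval_A :: "rat poly \<Rightarrow> (nat \<Rightarrow> int) set \<Rightarrow> (nat \<Rightarrow> int) set"
  where "eval_A F \<alpha> =
    (\<Oplus>\<^bsub>\<A>\<^esub> i\<in>{..Polynomial.degree F}. rat_A (Polynomial.coeff F i) \<otimes>\<^bsub>\<A>\<^esub> \<alpha> [^]\<^bsub>\<A>\<^esub> i)"

definition transcendental_A :: "(nat \<Rightarrow> int) set \<Rightarrow> bool"
  where "transcendental_A \<alpha> \<longleftrightarrow>
    \<alpha> \<in> carrier \<A> \<and> \<not> (\<exists>F :: rat poly. F \<noteq> 0 \<and> eval_A F \<alpha> = \<zero>\<^bsub>\<A>\<^esub>)"


text \<open>The remaining facts confirm that \<open>\<A>\<close> is a commutative ring and a \<open>\<rat>\<close>-algebra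
  via \<^const>\<open>rat_A\<close>.\<close>

lemma cring_ring_product:
  assumes "\<And>i. i \<in> I \<Longrightarrow> cring (R i)"
  shows "cring (ring_product I R)"
proof (rule cringI)
  have r: "ring (R i)" if "i \<in> I" for i
    using assms[OF that] by (rule cring.axioms)
  note cl = ring.ring_simprules[OF r]
  show "abelian_group (ring_product I R)"
  proof (rule abelian_groupI, goal_cases)
    case (6 x)
    then show ?case
      by (intro bexI[of _ "\<lambda>i\<in>I. \<ominus>\<^bsub>R i\<^esub> x i"])
        (auto simp: ring_product_def fun_eq_iff PiE_iff cl)
  qed (auto simp: ring_product_def fun_eq_iff PiE_iff extensional_def cl)
  show "Group.comm_monoid (ring_product I R)"
    by (rule Group.comm_monoidI)
      (auto simp: ring_product_def fun_eq_iff PiE_iff extensional_def cl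
        cring.cring_simprules[OF assms] monoid.r_one[OF ring.is_monoid[OF r]])
  show "(x \<oplus>\<^bsub>ring_product I R\<^esub> y) \<otimes>\<^bsub>ring_product I R\<^esub> z =
    x \<otimes>\<^bsub>ring_product I R\<^esub> z \<oplus>\<^bsub>ring_product I R\<^esub> y \<otimes>\<^bsub>ring_product I R\<^esub> z"
    if "x \<in> carrier (ring_product I R)" "y \<in> carrier (ring_product I R)"
      "z \<in> carrier (ring_product I R)" for x y z
    using that by (auto simp: ring_product_def fun_eq_iff PiE_iff cl)
qed

lemma a_inv_ring_product:
  assumes "\<And>i. i \<in> I \<Longrightarrow> cring (R i)" "x \<in> carrier (ring_product I R)"
  shows "\<ominus>\<^bsub>ring_product I R\<^esub> x = (\<lambda>i\<in>I. \<ominus>\<^bsub>R i\<^esub> x i)"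
proof -
  interpret P: cring "ring_product I R" using assms(1) by (rule cring_ring_product)
  have r: "ring (R i)" if "i \<in> I" for i
    using assms(1)[OF that] by (rule cring.axioms)
  note cl = ring.ring_simprules[OF r]
  show ?thesis
    by (rule P.minus_equality)
      (use assms(2) in \<open>auto simp: ring_product_def fun_eq_iff PiE_iff cl\<close>)
qed

lemma ideal_ring_direct_sum:
  assumes "\<And>i. i \<in> I \<Longrightarrow> cring (R i)"
  shows "ideal (ring_direct_sum I R) (ring_product I R)"
proof -
  interpret P: cring "ring_product I R" using assms by (rule cring_ring_product)
  have r: "ring (R i)" if "i \<in> I" for i
    using assms[OF that] by (rule cring.axioms)
  note cl = ring.ring_simprules[OF r]
  have sub: "ring_direct_sum I R \<subseteq> carrier (ring_product I R)"
    by (auto simp: ring_direct_sum_def ring_product_def)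
  have mult: "x \<otimes>\<^bsub>ring_product I R\<^esub> a \<in> ring_direct_sum I R"
    if "a \<in> ring_direct_sum I R" "x \<in> carrier (ring_product I R)" for a x
  proof -
    have "finite {i \<in> I. (x \<otimes>\<^bsub>ring_product I R\<^esub> a) i \<noteq> \<zero>\<^bsub>R i\<^esub>}"
      by (rule finite_subset[of _ "{i \<in> I. a i \<noteq> \<zero>\<^bsub>R i\<^esub>}"])
        (use that in \<open>auto simp: ring_product_def ring_direct_sum_def PiE_iff cl\<close>)
    then show ?thesis
      using P.m_closed[OF that(2)] that sub by (auto simp: ring_direct_sum_def ring_product_def)
  qed
  show ?thesis
  proof (rule idealI)
    show "ring (ring_product I R)" by (rule P.ring_axioms)
    show "subgroup (ring_direct_sum I R) (add_monoid (ring_product I R))"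
    proof (rule P.add.subgroupI)
      show "ring_direct_sum I R \<subseteq> carrier (ring_product I R)" by (rule sub)
      have "(\<lambda>i\<in>I. \<zero>\<^bsub>R i\<^esub>) \<in> ring_direct_sum I R"
        by (auto simp: ring_direct_sum_def cl)
      then show "ring_direct_sum I R \<noteq> {}" by blast
      show "\<ominus>\<^bsub>ring_product I R\<^esub> a \<in> ring_direct_sum I R" if a: "a \<in> ring_direct_sum I R" for a
      proof -
        have "\<ominus>\<^bsub>ring_product I R\<^esub> a = (\<lambda>i\<in>I. \<ominus>\<^bsub>R i\<^esub> a i)"
          using a sub by (intro a_inv_ring_product assms) auto
        moreover have "finite {i \<in> I. (\<lambda>i\<in>I. \<ominus>\<^bsub>R i\<^esub> a i) i \<noteq> \<zero>\<^bsub>R i\<^esub>}"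
          by (rule finite_subset[of _ "{i \<in> I. a i \<noteq> \<zero>\<^bsub>R i\<^esub>}"])
            (use a in \<open>auto simp: ring_direct_sum_def PiE_iff cl ring.minus_zero[OF r]\<close>)
        ultimately show ?thesis
          using a by (auto simp: ring_direct_sum_def PiE_iff cl)
      qed
      show "a \<oplus>\<^bsub>ring_product I R\<^esub> b \<in> ring_direct_sum I R"
        if ab: "a \<in> ring_direct_sum I R" "b \<in> ring_direct_sum I R" for a b
      proof -
        have "finite {i \<in> I. (a \<oplus>\<^bsub>ring_product I R\<^esub> b) i \<noteq> \<zero>\<^bsub>R i\<^esub>}"
          by (rule finite_subset[of _ "{i \<in> I. a i \<noteq> \<zero>\<^bsub>R i\<^esub>} \<union> {i \<in> I. b i \<noteq> \<zero>\<^bsub>R i\<^esub>}"])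
            (use ab in \<open>auto simp: ring_product_def ring_direct_sum_def PiE_iff cl\<close>)
        then show ?thesis
          using P.a_closed[of a b] ab sub by (auto simp: ring_direct_sum_def ring_product_def)
      qed
    qed
    show "x \<otimes>\<^bsub>ring_product I R\<^esub> a \<in> ring_direct_sum I R"
      if "a \<in> ring_direct_sum I R" "x \<in> carrier (ring_product I R)" for a x
      using that by (rule mult)
    show "a \<otimes>\<^bsub>ring_product I R\<^esub> x \<in> ring_direct_sum I R"
      if "a \<in> ring_direct_sum I R" "x \<in> carrier (ring_product I R)" for a x
      using mult[OF that] P.m_comm[of a x] that sub by auto
  qed
qed

lemma residues_prime_int: "prime p \<Longrightarrow> residues (int p)"
  using prime_gt_1_nat by (auto simp: residues_def)

lemma cring_prime_residue_ring: "p \<in> primes \<Longrightarrow> cring (residue_ring (int p))"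
  using residues.cring[OF residues_prime_int] by simp

lemma cring_prime_fields_product: "cring prime_fields_product"
  unfolding prime_fields_product_def
  by (rule cring_ring_product) (rule cring_prime_residue_ring)

lemma ideal_prime_fields_sum: "ideal prime_fields_sum prime_fields_product"
  unfolding prime_fields_product_def prime_fields_sum_def
  by (rule ideal_ring_direct_sum) (rule cring_prime_residue_ring)

lemma cring_ring_A: "cring \<A>"
  unfolding ring_A_def
  by (rule ideal.quotient_is_cring[OF ideal_prime_fields_sum cring_prime_fields_product])

interpretation ring_A: cring \<A>
  by (rule cring_ring_A)

lemma proj_ring_A_hom:
  "(\<lambda>x. prime_fields_sum +>\<^bsub>prime_fields_product\<^esub> x) \<in> ring_hom prime_fields_product \<A>"
  unfolding ring_A_def by (rule ideal.rcos_ring_hom[OF ideal_prime_fields_sum])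

lemma reps_in_product: "(\<lambda>p\<in>primes. a p mod int p) \<in> carrier prime_fields_product"
  by (auto simp: prime_fields_product_def ring_product_def residue_ring_def prime_gt_0_nat)

lemma image_A_closed [simp]: "image_A a \<in> carrier \<A>"
  unfolding image_A_def
  by (rule ring_hom_closed[OF proj_ring_A_hom reps_in_product])

lemma image_A_add: "image_A a \<oplus>\<^bsub>\<A>\<^esub> image_A b = image_A (\<lambda>p. a p + b p)"
  unfolding image_A_def ring_hom_add[OF proj_ring_A_hom reps_in_product reps_in_product, symmetric]
  by (rule arg_cong[where f = "\<lambda>x. prime_fields_sum +>\<^bsub>prime_fields_product\<^esub> x"])
    (auto simp: prime_fields_product_def ring_product_def residue_ring_def fun_eq_iff mod_simps)

lemma image_A_mult: "image_A a \<otimes>\<^bsub>\<A>\<^esub> image_A b = image_A (\<lambda>p. a p * b p)"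
  unfolding image_A_def ring_hom_mult[OF proj_ring_A_hom reps_in_product reps_in_product, symmetric]
  by (rule arg_cong[where f = "\<lambda>x. prime_fields_sum +>\<^bsub>prime_fields_product\<^esub> x"])
    (auto simp: prime_fields_product_def ring_product_def residue_ring_def fun_eq_iff mod_simps)

lemma image_A_one: "image_A (\<lambda>p. 1) = \<one>\<^bsub>\<A>\<^esub>"
proof -
  have "(\<lambda>p\<in>primes. 1 mod int p) = \<one>\<^bsub>prime_fields_product\<^esub>"
    by (auto simp: prime_fields_product_def ring_product_def residue_ring_def fun_eq_iff
        prime_gt_Suc_0_nat)
  then show ?thesis
    unfolding image_A_def using ring_hom_one[OF proj_ring_A_hom] by simp
qed

lemma image_A_eq_zero_iff:
  "image_A a = \<zero>\<^bsub>\<A>\<^esub> \<longleftrightarrow> finite {p \<in> primes. \<not> [a p = 0] (mod int p)}"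
proof -
  interpret I: ideal prime_fields_sum prime_fields_product by (rule ideal_prime_fields_sum)
  have "image_A a = \<zero>\<^bsub>\<A>\<^esub> \<longleftrightarrow> (\<lambda>p\<in>primes. a p mod int p) \<in> prime_fields_sum"
    unfolding image_A_def ring_A_def FactRing_def
    using I.a_rcos_const I.rcos_const_imp_mem[OF reps_in_product] by auto
  also have "\<dots> \<longleftrightarrow> finite {p \<in> primes. (\<lambda>p\<in>primes. a p mod int p) p \<noteq> 0}"
    using reps_in_product[of a]
    by (auto simp: prime_fields_sum_def ring_direct_sum_def prime_fields_product_def
        ring_product_def residue_ring_def)
  also have "{p \<in> primes. (\<lambda>p\<in>primes. a p mod int p) p \<noteq> 0} =
      {p \<in> primes. \<not> [a p = 0] (mod int p)}"
    by (auto simp: cong_def)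
  finally show ?thesis .
qed

lemma image_A_zero: "image_A (\<lambda>p. 0) = \<zero>\<^bsub>\<A>\<^esub>"
  by (simp add: image_A_eq_zero_iff)

lemma image_A_uminus: "\<ominus>\<^bsub>\<A>\<^esub> image_A a = image_A (\<lambda>p. - a p)"
  by (rule ring_A.minus_equality) (auto simp: image_A_add image_A_zero)

lemma image_A_eq_iff:
  "image_A a = image_A b \<longleftrightarrow> finite {p \<in> primes. \<not> [a p = b p] (mod int p)}"
proof -
  have "image_A a = image_A b \<longleftrightarrow> image_A a \<ominus>\<^bsub>\<A>\<^esub> image_A b = \<zero>\<^bsub>\<A>\<^esub>"
    by simp
  also have "image_A a \<ominus>\<^bsub>\<A>\<^esub> image_A b = image_A (\<lambda>p. a p - b p)"
    by (simp add: a_minus_def image_A_uminus image_A_add)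
  finally show ?thesis
    by (simp add: image_A_eq_zero_iff cong_diff_iff_cong_0)
qed

lemma int_ring_A: "[n] \<cdot>\<^bsub>\<A>\<^esub> \<one>\<^bsub>\<A>\<^esub> = image_A (\<lambda>p. n)" for n :: int
proof -
  have nat: "[k] \<cdot>\<^bsub>\<A>\<^esub> \<one>\<^bsub>\<A>\<^esub> = image_A (\<lambda>p. int k)" for k :: nat
    by (induction k)
      (simp_all add: image_A_zero image_A_one[symmetric] image_A_add add.commute)
  show ?thesis
    by (cases "n \<ge> 0") (simp_all add: add_pow_int_ge add_pow_int_lt nat image_A_uminus)
qed

lemma ring_A_int_Units:
  assumes "n \<noteq> (0::int)"
  shows "[n] \<cdot>\<^bsub>\<A>\<^esub> \<one>\<^bsub>\<A>\<^esub> \<in> Units \<A>"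
proof -
  define b where "b p = (SOME x. [n * x = 1] (mod int p))" for p :: nat
  have b: "[n * b p = 1] (mod int p)" if "prime p" "\<not> int p dvd n" for p
  proof -
    have "coprime n (int p)"
      using that by (metis coprime_commute prime_imp_coprime prime_nat_int_transfer)
    then obtain x where "[n * x = 1] (mod int p)"
      using cong_solve_coprime_int by blast
    then show ?thesis
      unfolding b_def by (rule someI)
  qed
  have "finite {p \<in> primes. \<not> [n * b p = 1] (mod int p)}"
  proof (rule finite_subset)
    show "{p \<in> primes. \<not> [n * b p = 1] (mod int p)} \<subseteq> {p. p dvd nat \<bar>n\<bar>}"
      using b by (auto simp: dvd_nat_abs_iff)
    show "finite {p. p dvd nat \<bar>n\<bar>}"
      by (rule finite_divisors_nat) (use assms in simp)
  qed
  then have "image_A (\<lambda>p. n) \<otimes>\<^bsub>\<A>\<^esub> image_A b = \<one>\<^bsub>\<A>\<^esub>"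
    by (simp add: image_A_mult image_A_one[symmetric] image_A_eq_iff)
  then show ?thesis
    unfolding int_ring_A Units_def using ring_A.m_comm[of "image_A b" "image_A (\<lambda>p. n)"]
    by (auto intro!: bexI[of _ "image_A b"])
qed

lemma rat_A_closed [simp]: "rat_A q \<in> carrier \<A>"
  using ring_A_int_Units[of "snd (quotient_of q)"] quotient_of_denom_pos'[of q]
  by (auto simp: rat_A_def int_ring_A split: prod.splits)

lemma rat_A_eqI:
  assumes "n \<noteq> 0" "q = of_int m / of_int n" "x \<in> carrier \<A>"
    "image_A (\<lambda>p. n) \<otimes>\<^bsub>\<A>\<^esub> x = image_A (\<lambda>p. m)"
  shows "rat_A q = x"
proof -
  obtain a b where ab: "quotient_of q = (a, b)" by fastforce
  then have b: "b > 0" and q: "q = of_int a / of_int b"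
    by (simp_all add: quotient_of_denom_pos quotient_of_div)
  have "of_int (a * n) = (of_int (m * b) :: rat)"
    using assms(1,2) q b by (simp add: field_simps)
  then have an: "a * n = m * b" by (simp only: of_int_eq_iff)
  let ?b = "image_A (\<lambda>p. b)" and ?n = "image_A (\<lambda>p. n)"
  have U: "?b \<in> Units \<A>" "?n \<in> Units \<A>"
    using ring_A_int_Units[of b] ring_A_int_Units[of n] b assms(1) by (auto simp: int_ring_A)
  have "?n \<otimes>\<^bsub>\<A>\<^esub> (?b \<otimes>\<^bsub>\<A>\<^esub> x) = ?b \<otimes>\<^bsub>\<A>\<^esub> (?n \<otimes>\<^bsub>\<A>\<^esub> x)"
    using assms(3) by (simp add: ring_A.m_lcomm)
  also have "\<dots> = ?n \<otimes>\<^bsub>\<A>\<^esub> image_A (\<lambda>p. a)"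
    unfolding assms(4) image_A_mult using an by (simp add: mult.commute)
  finally have bx: "?b \<otimes>\<^bsub>\<A>\<^esub> x = image_A (\<lambda>p. a)"
    using U(2) assms(3) by (subst (asm) ring_A.Units_l_cancel) auto
  have "rat_A q = ?b \<otimes>\<^bsub>\<A>\<^esub> x \<otimes>\<^bsub>\<A>\<^esub> inv\<^bsub>\<A>\<^esub> ?b"
    by (simp add: rat_A_def ab int_ring_A bx)
  also have "\<dots> = x \<otimes>\<^bsub>\<A>\<^esub> (?b \<otimes>\<^bsub>\<A>\<^esub> inv\<^bsub>\<A>\<^esub> ?b)"
    using U assms(3) by (simp add: ring_A.m_assoc ring_A.m_comm[of ?b x] del: ring_A.Units_r_inv)
  also have "\<dots> = x"
    using U assms(3) by simp
  finally show ?thesis .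
qed

lemma denom_times_rat_A:
  assumes "quotient_of q = (m, n)"
  shows "image_A (\<lambda>p. n) \<otimes>\<^bsub>\<A>\<^esub> rat_A q = image_A (\<lambda>p. m)"
proof -
  have U: "image_A (\<lambda>p. n) \<in> Units \<A>"
    using ring_A_int_Units[of n] quotient_of_denom_pos[OF assms] by (simp add: int_ring_A)
  then show ?thesis
    by (simp add: rat_A_def assms int_ring_A ring_A.m_lcomm)
qed

lemma rat_A_of_int: "rat_A (of_int m) = image_A (\<lambda>p. m)"
  by (rule rat_A_eqI[of 1 _ m]) (auto simp: image_A_mult)

lemma rat_A_mult: "rat_A (q * r) = rat_A q \<otimes>\<^bsub>\<A>\<^esub> rat_A r"
proof -
  obtain a b c d where q: "quotient_of q = (a, b)" and r: "quotient_of r = (c, d)"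
    by (metis surj_pair)
  have pos: "b > 0" "d > 0"
    using quotient_of_denom_pos[OF q] quotient_of_denom_pos[OF r] by auto
  note eqs = denom_times_rat_A[OF q] denom_times_rat_A[OF r]
  show ?thesis
  proof (rule rat_A_eqI[of "b * d" _ "a * c"])
    show "q * r = of_int (a * c) / of_int (b * d)"
      using quotient_of_div[OF q] quotient_of_div[OF r] by simp
    have "image_A (\<lambda>p. b * d) \<otimes>\<^bsub>\<A>\<^esub> (rat_A q \<otimes>\<^bsub>\<A>\<^esub> rat_A r) =
      (image_A (\<lambda>p. b) \<otimes>\<^bsub>\<A>\<^esub> rat_A q) \<otimes>\<^bsub>\<A>\<^esub> (image_A (\<lambda>p. d) \<otimes>\<^bsub>\<A>\<^esub> rat_A r)"
      by (simp add: image_A_mult[symmetric] ring_A.m_assoc ring_A.m_lcomm)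
    then show "image_A (\<lambda>p. b * d) \<otimes>\<^bsub>\<A>\<^esub> (rat_A q \<otimes>\<^bsub>\<A>\<^esub> rat_A r) = image_A (\<lambda>p. a * c)"
      unfolding eqs by (simp add: image_A_mult)
  qed (use pos in auto)
qed

lemma rat_A_add: "rat_A (q + r) = rat_A q \<oplus>\<^bsub>\<A>\<^esub> rat_A r"
proof -
  obtain a b c d where q: "quotient_of q = (a, b)" and r: "quotient_of r = (c, d)"
    by (metis surj_pair)
  have pos: "b > 0" "d > 0"
    using quotient_of_denom_pos[OF q] quotient_of_denom_pos[OF r] by auto
  note eqs = denom_times_rat_A[OF q] denom_times_rat_A[OF r]
  show ?thesis
  proof (rule rat_A_eqI[of "b * d" _ "d * a + b * c"])
    show "q + r = of_int (d * a + b * c) / of_int (b * d)"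
      using quotient_of_div[OF q] quotient_of_div[OF r] pos by (simp add: field_simps)
    have "image_A (\<lambda>p. b * d) \<otimes>\<^bsub>\<A>\<^esub> (rat_A q \<oplus>\<^bsub>\<A>\<^esub> rat_A r) =
      image_A (\<lambda>p. d) \<otimes>\<^bsub>\<A>\<^esub> (image_A (\<lambda>p. b) \<otimes>\<^bsub>\<A>\<^esub> rat_A q) \<oplus>\<^bsub>\<A>\<^esub>
      image_A (\<lambda>p. b) \<otimes>\<^bsub>\<A>\<^esub> (image_A (\<lambda>p. d) \<otimes>\<^bsub>\<A>\<^esub> rat_A r)"
      by (simp add: image_A_mult[symmetric] ring_A.r_distr ring_A.m_assoc ring_A.m_lcomm)
    then show "image_A (\<lambda>p. b * d) \<otimes>\<^bsub>\<A>\<^esub> (rat_A q \<oplus>\<^bsub>\<A>\<^esub> rat_A r) =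
        image_A (\<lambda>p. d * a + b * c)"
      unfolding eqs by (simp add: image_A_mult image_A_add)
  qed (use pos in auto)
qed

lemma rat_A_hom:
  "rat_A \<in> ring_hom \<lparr>carrier = UNIV, monoid.mult = (*), one = 1, zero = 0, add = (+)\<rparr> \<A>"
  using rat_A_of_int[of 1]
  by (intro ring_hom_memI) (auto simp: rat_A_mult rat_A_add image_A_one)

end

theory Submission
  imports Defs "HOL-Computational_Algebra.Squarefree"
begin

text \<open>Suppose a nonzero integer polynomial \<open>f\<close> of degree \<open>d\<close> kills the image of \<open>R'\<close>. Multiplying
  \<open>f (R' p)\<close> by \<open>R ^ d\<close> shows that almost every prime \<open>p\<close> divides \<open>g R\<close>, where \<open>g\<close> is the reflected
  polynomial. For \<open>2 ^ n \<le> p < 2 ^ (n + 1)\<close> the power \<open>R\<close> is one of \<open>2 ^ (n + 1), \<dots>, 2 ^ (n + k)\<close>,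
  and each nonzero \<open>g (2 ^ (n + j))\<close>, being at most \<open>2 ^ (n (2 d + 1))\<close> in absolute value, has at most
  \<open>2 d + 1\<close> prime divisors of size \<open>2 ^ n\<close> or more. Hence large dyadic intervals contain at most
  \<open>k (2 d + 1)\<close> primes each, so the sum of the reciprocals of the primes converges. The argument of
  Erdos for the divergence of this sum gives a contradiction.\<close>

section \<open>Prime divisors, multiples and smooth numbers\<close>

lemma prod_primes_dvd:
  fixes z :: nat
  assumes "finite P" "\<And>p. p \<in> P \<Longrightarrow> prime p" "\<And>p. p \<in> P \<Longrightarrow> p dvd z"
  shows "\<Prod>P dvd z"
  using assms
proof (induction P rule: finite_induct)
  case (insert x P)
  have "coprime x (\<Prod>P)"
    by (rule prod_coprime_right) (use insert in \<open>auto intro!: primes_coprime\<close>)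
  then show ?case
    using insert by (auto intro!: divides_mult)
qed simp

text \<open>The product of the distinct primes in \<open>P\<close> divides \<open>z\<close>, hence
  is at most \<open>z\<close>, and each of its factors is at least \<open>b\<close>.\<close>

lemma power_card_prime_divisors_le:
  fixes z :: nat
  assumes "z > 0" "\<And>p. p \<in> P \<Longrightarrow> prime p" "\<And>p. p \<in> P \<Longrightarrow> p dvd z" "\<And>p. p \<in> P \<Longrightarrow> b \<le> p"
  shows "finite P" "b ^ card P \<le> z"
proof -
  show fin: "finite P"
    by (rule finite_subset[OF _ finite_divisors_nat[OF assms(1)]]) (use assms(3) in auto)
  have "b ^ card P \<le> \<Prod>P"
    using prod_mono[of P "\<lambda>_. b" "\<lambda>p. p"] assms(4) by simp
  also have "\<dots> \<le> z"
    using prod_primes_dvd[OF fin assms(2,3)] assms(1) by (auto intro: dvd_imp_le)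
  finally show "b ^ card P \<le> z" .
qed

lemma card_multiples_le:
  fixes p x :: nat
  assumes "p > 0"
  shows "card {n \<in> {1..x}. p dvd n} \<le> x div p"
proof -
  have "{n \<in> {1..x}. p dvd n} \<subseteq> (\<lambda>i. p * i) ` {1..x div p}"
  proof
    fix n assume n: "n \<in> {n \<in> {1..x}. p dvd n}"
    then obtain i where "n = p * i" by auto
    with n assms show "n \<in> (\<lambda>i. p * i) ` {1..x div p}"
      by (auto simp: less_eq_div_iff_mult_less_eq mult.commute intro!: imageI)
  qed
  then have "card {n \<in> {1..x}. p dvd n} \<le> card {1..x div p}"
    by (rule surj_card_le[rotated]) simp
  then show ?thesis by simp
qed

text \<open>Every prime factor has multiplicity one. Thus a squarefree number can be encoded by its
  set of primes, which is how \<open>card_smooth_le\<close> counts.\<close>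

lemma squarefree_eq_prod_prime_factors:
  fixes n :: nat
  assumes "squarefree n"
  shows "n = \<Prod>(prime_factors n)"
proof -
  have n: "n \<noteq> 0" using assms by (metis not_squarefree_0)
  have "n = (\<Prod>p\<in>prime_factors n. p ^ multiplicity p n)"
    using prod_prime_factors[OF n] by simp
  also have "\<dots> = \<Prod>(prime_factors n)"
  proof (rule prod.cong[OF refl])
    fix p assume p: "p \<in> prime_factors n"
    then have "multiplicity p n = 1"
      using assms n squarefree_factorial_semiring'[of n] by auto
    then show "p ^ multiplicity p n = p" by simp
  qed
  finally show ?thesis .
qed

text \<open>Each \<open>n\<close> is determined by the primes of its squarefree part, a subset of
  \<open>{..<B}\<close>, and by its square part, which is at most \<open>x\<close> because its
  square divides \<open>n\<close>. Counting up to a perfect square keeps square roots out of the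
  bound.\<close>

lemma card_smooth_le:
  fixes B x :: nat
  shows "card {n \<in> {1..x\<^sup>2}. \<forall>p\<in>prime_factors n. p < B} \<le> 2 ^ B * x" (is "card ?S \<le> _")
proof -
  define h where "h n = (prime_factors (squarefree_part n), square_part n)" for n :: nat
  have "inj_on h ?S"
  proof (rule inj_onI)
    fix m n assume "h m = h n"
    then have "squarefree_part m = squarefree_part n" "square_part m = square_part n"
      using squarefree_eq_prod_prime_factors[OF squarefree_squarefree_part, of m]
        squarefree_eq_prod_prime_factors[OF squarefree_squarefree_part, of n]
      by (auto simp: h_def)
    then show "m = n" using squarefree_decomposition_unique by blast
  qed
  moreover have "h ` ?S \<subseteq> Pow {..<B} \<times> {1..x}"
  proof
    fix y assume "y \<in> h ` ?S"
    then obtain n where n: "1 \<le> n" "n \<le> x\<^sup>2" "\<And>p. p \<in> prime_factors n \<Longrightarrow> p < B" and y: "y = h n"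
      by auto
    have "squarefree_part n dvd n"
      by (subst (2) squarefree_decompose[of n]) simp
    then have "prime_factors (squarefree_part n) \<subseteq> prime_factors n"
      using n(1) by (intro dvd_prime_factors) auto
    moreover have "square_part n ^ 2 \<le> x ^ 2"
      using n(1,2) dvd_imp_le[OF square_part_square_dvd[of n]] by linarith
    then have "square_part n \<le> x" by (rule power2_le_imp_le) simp
    moreover have "square_part n \<noteq> 0" using n(1) by simp
    then have "1 \<le> square_part n" by linarith
    ultimately show "y \<in> Pow {..<B} \<times> {1..x}" using n(3) y by (auto simp: h_def)
  qed
  ultimately have "card ?S \<le> card (Pow {..<B} \<times> {1..x})"
    by (intro card_inj_on_le[of h]) auto
  then show ?thesis by (simp add: card_cartesian_product card_Pow)
qed

section \<open>Primes in dyadic intervals\<close>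

definition dyadic_primes :: "nat \<Rightarrow> nat set"
  where "dyadic_primes n = {p. prime p \<and> 2 ^ n \<le> p \<and> p < 2 ^ (n + 1)}"

lemma finite_dyadic_primes [simp]: "finite (dyadic_primes n)"
  by (rule finite_subset[of _ "{..<2 ^ (n + 1)}"]) (auto simp: dyadic_primes_def)

lemma ex_dyadic_interval:
  fixes p :: nat
  assumes "p > 0"
  obtains n where "2 ^ n \<le> p" "p < 2 ^ (n + 1)"
  using ex_power_ivl1[of 2 p] assms by auto

text \<open>Were \<open>C\<close> a bound from \<open>N\<close> on, the multiples of primes in the
  intervals with \<open>n \<ge> M\<close> would make up at most half of the numbers up to
  \<open>X\<close>. The other half would have only prime factors below \<open>2 ^ M\<close>, but of
  such numbers there are only about \<open>sqrt X\<close>, up to a constant depending on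
  \<open>M\<close>.\<close>

lemma card_dyadic_primes_unbounded: "\<exists>n\<ge>N. card (dyadic_primes n) > C"
proof (rule ccontr)
  assume "\<not> ?thesis"
  then have C: "card (dyadic_primes n) \<le> C" if "n \<ge> N" for n using that by auto
  \<comment> \<open>\<open>M\<close> exceeds \<open>N\<close> and satisfies
    \<open>4 * C \<le> 2 ^ M\<close>, which makes the geometric tail at most \<open>X / 2\<close>.
    The summand 2 in \<open>L\<close> is the least that refutes the final inequality
    \<open>2 * L \<le> 1 + 2 ^ M + L\<close>. \<open>X\<close> is a square, as
    \<open>card_smooth_le\<close> requires.\<close>
  define M where "M = N + C + 2"
  define L where "L = 2 ^ M + (2::nat)"
  define X where "X = ((2::nat) ^ L)\<^sup>2"
  have X: "X = 2 ^ (2 * L)" by (simp add: X_def power_mult [symmetric] mult.commute)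
  let ?S = "{n \<in> {1..X}. \<forall>p\<in>prime_factors n. p < 2 ^ M}"
  let ?D = "\<lambda>p. {n \<in> {1..X}. p dvd n}"
  \<comment> \<open>A number that is not smooth has a prime factor \<open>p \<ge> 2 ^ M\<close>.
    From \<open>p \<le> X = 2 ^ (2 * L)\<close> the index of its dyadic interval is at most
    \<open>2 * L\<close>, so finitely many intervals suffice.\<close>
  have cover: "{1..X} \<subseteq> ?S \<union> (\<Union>n\<in>{M..2 * L}. \<Union>p\<in>dyadic_primes n. ?D p)"
  proof
    fix m assume m: "m \<in> {1..X}"
    show "m \<in> ?S \<union> (\<Union>n\<in>{M..2 * L}. \<Union>p\<in>dyadic_primes n. ?D p)"
    proof (cases "m \<in> ?S")
      case False
      then obtain p where p: "prime p" "p dvd m" "2 ^ M \<le> p"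
        using m by (auto simp: not_less)
      obtain n where n: "2 ^ n \<le> p" "p < 2 ^ (n + 1)"
        using ex_dyadic_interval[of p] p(1) prime_gt_0_nat by blast
      have "(2::nat) ^ M < 2 ^ (n + 1)" using p(3) n(2) by linarith
      then have "M < n + 1" by (rule power_less_imp_less_exp[rotated]) simp
      moreover have "p \<le> X" using p(2) m dvd_imp_le[of p m] by auto
      then have "(2::nat) ^ n \<le> 2 ^ (2 * L)" using n(1) X by linarith
      then have "n \<le> 2 * L" by (rule power_le_imp_le_exp[rotated]) simp
      ultimately have "n \<in> {M..2 * L}" "p \<in> dyadic_primes n" "m \<in> ?D p"
        using n p m by (auto simp: dyadic_primes_def)
      then show ?thesis by blast
    qed simp
  qed
  have block: "card (\<Union>p\<in>dyadic_primes n. ?D p) \<le> C * (X div 2 ^ n)" if n: "n \<in> {M..2 * L}" for n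
  proof -
    have "card (\<Union>p\<in>dyadic_primes n. ?D p) \<le> (\<Sum>p\<in>dyadic_primes n. card (?D p))"
      by (rule card_UN_le) simp
    also have "\<dots> \<le> (\<Sum>p\<in>dyadic_primes n. X div 2 ^ n)"
    proof (rule sum_mono)
      fix p assume p: "p \<in> dyadic_primes n"
      have "card (?D p) \<le> X div p"
        by (rule card_multiples_le) (use p in \<open>auto simp: dyadic_primes_def prime_gt_0_nat\<close>)
      also have "\<dots> \<le> X div 2 ^ n"
        by (rule div_le_mono2) (use p in \<open>auto simp: dyadic_primes_def\<close>)
      finally show "card (?D p) \<le> X div 2 ^ n" .
    qed
    also have "\<dots> \<le> C * (X div 2 ^ n)"
      using C[of n] n by (simp add: M_def)
    finally show ?thesis .
  qed
  have "card (\<Union>n\<in>{M..2 * L}. \<Union>p\<in>dyadic_primes n. ?D p) \<le> (\<Sum>n\<in>{M..2 * L}. C * (X div 2 ^ n))"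
    by (rule order.trans[OF card_UN_le sum_mono[OF block]]) simp_all
  moreover have "card ?S \<le> 2 ^ (2 ^ M) * 2 ^ L"
    unfolding X_def by (rule card_smooth_le)
  moreover have "card {1..X} \<le> card (?S \<union> (\<Union>n\<in>{M..2 * L}. \<Union>p\<in>dyadic_primes n. ?D p))"
    by (rule card_mono[OF _ cover]) auto
  moreover have "\<dots> \<le> card ?S + card (\<Union>n\<in>{M..2 * L}. \<Union>p\<in>dyadic_primes n. ?D p)"
    by (rule card_Un_le)
  ultimately have "X \<le> 2 ^ (2 ^ M) * 2 ^ L + (\<Sum>n\<in>{M..2 * L}. C * (X div 2 ^ n))"
    by simp
  \<comment> \<open>The geometric sum from \<open>M\<close> on is at most
    \<open>2 * (1 / 2) ^ M\<close>. Real numbers absorb the rounding in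
    \<open>X div 2 ^ n\<close>.\<close>
  moreover have "2 * (\<Sum>n\<in>{M..2 * L}. C * (X div 2 ^ n)) \<le> X"
  proof -
    have div: "real (X div 2 ^ n) \<le> real X * (1 / 2) ^ n" for n
      using of_nat_div_le_of_nat[of X "2 ^ n", where 'a = real] by (simp add: power_divide)
    have "real (\<Sum>n\<in>{M..2 * L}. C * (X div 2 ^ n)) \<le> (\<Sum>n\<in>{M..2 * L}. real C * (real X * (1 / 2) ^ n))"
      unfolding of_nat_sum of_nat_mult by (intro sum_mono mult_left_mono div) simp
    also have "\<dots> = real (C * X) * (\<Sum>n\<in>{M..2 * L}. (1 / 2) ^ n)"
      by (simp add: sum_distrib_left mult.assoc)
    also have "\<dots> \<le> real (C * X) * (2 * (1 / 2) ^ M)"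
      by (rule mult_left_mono) (simp_all add: sum_gp)
    also have "\<dots> = (4 * real C * (1 / 2) ^ M) * real X / 2" by simp
    finally have "real (\<Sum>n\<in>{M..2 * L}. C * (X div 2 ^ n)) \<le> (4 * real C * (1 / 2) ^ M) * real X / 2" .
    moreover have "4 * C \<le> 4 * 2 ^ C" using less_exp[of C] by simp
    then have "4 * C \<le> 2 ^ M"
      by (rule order.trans) (simp add: M_def power_add)
    then have "real (4 * C) \<le> real (2 ^ M)" by (rule of_nat_mono)
    then have "4 * real C * (1 / 2) ^ M \<le> 1" by (simp add: power_divide)
    then have "4 * real C * (1 / 2) ^ M * real X \<le> 1 * real X"
      by (rule mult_right_mono) simp
    ultimately have "real (\<Sum>n\<in>{M..2 * L}. C * (X div 2 ^ n)) \<le> real X / 2" by linarith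
    then have "real (2 * (\<Sum>n\<in>{M..2 * L}. C * (X div 2 ^ n))) \<le> real X" by simp
    then show ?thesis by (simp only: of_nat_le_iff)
  qed
  ultimately have "X \<le> 2 * (2 ^ (2 ^ M) * 2 ^ L)" by linarith
  then have "(2::nat) ^ (2 * L) \<le> 2 ^ (1 + 2 ^ M + L)" by (simp add: X power_add)
  then have "2 * L \<le> 1 + 2 ^ M + L" by (rule power_le_imp_le_exp[rotated]) simp
  then show False by (simp add: L_def)
qed

section \<open>From relations in \<open>\<A>\<close> to congruences modulo primes\<close>

text \<open>Induction on the coefficients: the multiplier for the tail is multiplied by the
  denominator of the new constant term.\<close>

lemma clear_denominators:
  fixes F :: "rat poly"
  obtains d :: int and f :: "int poly"
  where "d \<noteq> 0" "Polynomial.smult (of_int d) F = map_poly of_int f"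
proof -
  have "\<exists>d f. d \<noteq> 0 \<and> Polynomial.smult (of_int d) F = map_poly of_int f"
  proof (induction F rule: pCons_induct)
    case 0
    show ?case by (rule exI[of _ 1], rule exI[of _ 0]) simp
  next
    case (pCons a F)
    then obtain d f where d: "d \<noteq> 0" "Polynomial.smult (of_int d) F = map_poly of_int f" by blast
    obtain m n where mn: "quotient_of a = (m, n)" by fastforce
    have n: "n > 0" using quotient_of_denom_pos[OF mn] .
    have a: "of_int n * a = of_int m" using quotient_of_div[OF mn] n by simp
    have "map_poly of_int (Polynomial.smult n f) = Polynomial.smult (of_int n :: rat) (map_poly of_int f)"
      by (rule poly_eqI) (simp add: coeff_map_poly)
    then have "Polynomial.smult (of_int (n * d)) (pCons a F) =
        map_poly of_int (pCons (m * d) (Polynomial.smult n f))"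
      using a by (simp add: map_poly_pCons d(2)[symmetric] mult_ac)
    then show ?case using d n by (intro exI[of _ "n * d"] exI) auto
  qed
  then show ?thesis using that by blast
qed

lemma image_A_power: "image_A a [^]\<^bsub>\<A>\<^esub> n = image_A (\<lambda>p. a p ^ n)" for n :: nat
  by (induction n) (auto simp: image_A_one image_A_mult mult.commute)

lemma image_A_sum:
  assumes "finite I"
  shows "(\<Oplus>\<^bsub>\<A>\<^esub> i\<in>I. image_A (a i)) = image_A (\<lambda>p. \<Sum>i\<in>I. a i p)"
  using assms
  by (induction I rule: finite_induct) (auto simp: image_A_zero image_A_add ring_A.finsum_insert)

text \<open>After multiplication by \<open>d\<close> the value becomes the image of an integer
  sequence, and such an image vanishes only if almost all primes divide their terms.\<close>

lemma eval_A_eq_zeroD: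
  assumes "Polynomial.smult (of_int d) F = map_poly of_int f" "d \<noteq> 0"
    and "eval_A F (image_A a) = \<zero>\<^bsub>\<A>\<^esub>"
  shows "finite {p \<in> primes. \<not> [poly f (a p) = 0] (mod int p)}"
proof -
  have deg: "Polynomial.degree F = Polynomial.degree f"
    using arg_cong[OF assms(1), of Polynomial.degree] assms(2) by (simp add: degree_map_poly)
  have cf: "of_int d * Polynomial.coeff F i = of_int (Polynomial.coeff f i)" for i
    using arg_cong[OF assms(1), of "\<lambda>q. Polynomial.coeff q i"] by (simp add: coeff_map_poly)
  \<comment> \<open>Writing the factor as \<open>rat_A (of_int d)\<close> lets
    \<open>rat_A_mult\<close> merge it with each rational coefficient into an integer one.\<close>
  have "image_A (\<lambda>p. d) \<otimes>\<^bsub>\<A>\<^esub> eval_A F (image_A a) =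
      (\<Oplus>\<^bsub>\<A>\<^esub> i\<in>{..Polynomial.degree F}. rat_A (of_int d) \<otimes>\<^bsub>\<A>\<^esub>
        (rat_A (Polynomial.coeff F i) \<otimes>\<^bsub>\<A>\<^esub> image_A a [^]\<^bsub>\<A>\<^esub> i))"
    unfolding eval_A_def rat_A_of_int[symmetric]
    by (rule ring_A.finsum_rdistr) auto
  also have "\<dots> = (\<Oplus>\<^bsub>\<A>\<^esub> i\<in>{..Polynomial.degree f}. image_A (\<lambda>p. Polynomial.coeff f i * a p ^ i))"
    by (rule ring_A.finsum_cong')
      (simp_all add: deg ring_A.m_assoc[symmetric] rat_A_mult[symmetric] cf,
       simp_all add: rat_A_of_int image_A_power image_A_mult)
  also have "\<dots> = image_A (\<lambda>p. poly f (a p))"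
    by (simp add: image_A_sum poly_altdef)
  finally have "image_A (\<lambda>p. poly f (a p)) = \<zero>\<^bsub>\<A>\<^esub>"
    using assms(3) by simp
  then show ?thesis by (simp add: image_A_eq_zero_iff)
qed

section \<open>Reflected polynomials at modular inverses\<close>

lemma poly_reflect_poly_eq_sum:
  fixes f :: "'a :: comm_semiring_1 poly"
  shows "poly (reflect_poly f) x = (\<Sum>i\<le>Polynomial.degree f. Polynomial.coeff f i * x ^ (Polynomial.degree f - i))"
proof -
  have "poly (reflect_poly f) x =
      (\<Sum>i\<le>Polynomial.degree f. Polynomial.coeff (reflect_poly f) i * x ^ i)"
    unfolding poly_altdef
    \<comment> \<open>The reflected polynomial has smaller degree than \<open>f\<close> if the
      constant term of \<open>f\<close> vanishes; the added coefficients are zero.\<close>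
    by (rule sum.mono_neutral_left) (auto simp: coeff_eq_0 intro: degree_reflect_poly_le)
  also have "\<dots> = (\<Sum>i\<le>Polynomial.degree f. Polynomial.coeff f (Polynomial.degree f - i) * x ^ i)"
    by (rule sum.cong) (auto simp: coeff_reflect_poly)
  also have "\<dots> = (\<Sum>i\<le>Polynomial.degree f. Polynomial.coeff f i * x ^ (Polynomial.degree f - i))"
    by (rule sum.reindex_bij_witness[of _ "\<lambda>i. Polynomial.degree f - i" "\<lambda>i. Polynomial.degree f - i"]) auto
  finally show ?thesis .
qed

text \<open>With \<open>D\<close> the degree of \<open>f\<close>, the monomial
  \<open>y ^ D * x ^ i\<close> equals \<open>y ^ (D - i) * (x * y) ^ i\<close>, and the last factor
  is 1 modulo \<open>m\<close>.\<close>

lemma cong_poly_reflect_poly: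
  fixes f :: "int poly"
  assumes "[x * y = 1] (mod m)"
  shows "[poly (reflect_poly f) y = y ^ Polynomial.degree f * poly f x] (mod m)"
proof -
  have "[Polynomial.coeff f i * y ^ (Polynomial.degree f - i) =
      y ^ Polynomial.degree f * (Polynomial.coeff f i * x ^ i)] (mod m)"
    if i: "i \<le> Polynomial.degree f" for i
  proof -
    have "y ^ Polynomial.degree f * (Polynomial.coeff f i * x ^ i) =
        Polynomial.coeff f i * y ^ (Polynomial.degree f - i) * (x * y) ^ i"
      using i by (simp add: power_mult_distrib power_add[symmetric] mult_ac)
    moreover have "[Polynomial.coeff f i * y ^ (Polynomial.degree f - i) * (x * y) ^ i =
        Polynomial.coeff f i * y ^ (Polynomial.degree f - i) * 1 ^ i] (mod m)"
      by (intro cong_mult cong_refl cong_pow assms)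
    ultimately show ?thesis by (metis cong_sym mult.right_neutral power_one)
  qed
  then show ?thesis
    unfolding poly_reflect_poly_eq_sum poly_altdef[of f] sum_distrib_left
    by (intro cong_sum) auto
qed

section \<open>Large prime divisors of polynomial values at powers of two\<close>

lemma abs_poly_le:
  fixes g :: "int poly"
  assumes "x \<ge> 1"
  shows "\<bar>poly g x\<bar> \<le> (\<Sum>i\<le>Polynomial.degree g. \<bar>Polynomial.coeff g i\<bar>) * x ^ Polynomial.degree g"
proof -
  have "\<bar>poly g x\<bar> \<le> (\<Sum>i\<le>Polynomial.degree g. \<bar>Polynomial.coeff g i * x ^ i\<bar>)"
    unfolding poly_altdef by (rule sum_abs)
  also have "\<dots> \<le> (\<Sum>i\<le>Polynomial.degree g. \<bar>Polynomial.coeff g i\<bar> * x ^ Polynomial.degree g)"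
    using assms by (intro sum_mono) (auto simp: abs_mult intro!: mult_left_mono power_increasing)
  finally show ?thesis by (simp add: sum_distrib_right)
qed

text \<open>For large \<open>n\<close> the value is nonzero and at most
  \<open>2 ^ (n * (2 * degree g + 1))\<close> in absolute value, while each prime counted
  contributes a factor of at least \<open>2 ^ n\<close>. The threshold serves all shifts
  \<open>j \<le> k\<close> at once.\<close>

lemma eventually_card_prime_divisors_le:
  fixes g :: "int poly"
  assumes "g \<noteq> 0"
  shows "\<exists>N. \<forall>n\<ge>N. \<forall>j\<le>k.
    finite {p. prime p \<and> 2 ^ n \<le> p \<and> int p dvd poly g (2 ^ (n + j))} \<and>
    card {p. prime p \<and> 2 ^ n \<le> p \<and> int p dvd poly g (2 ^ (n + j))} \<le> 2 * Polynomial.degree g + 1"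
proof -
  define S where "S = (\<Sum>i\<le>Polynomial.degree g. \<bar>Polynomial.coeff g i\<bar>)"
  \<comment> \<open>Only finitely many powers of 2 are roots of \<open>g\<close>.\<close>
  have "finite ((\<lambda>n. 2 ^ n :: int) -` {x. poly g x = 0})"
    by (intro finite_vimageI poly_roots_finite assms) (auto intro: injI)
  then obtain N where N: "\<And>n. poly g (2 ^ n) = 0 \<Longrightarrow> n \<le> N"
    by (auto simp: finite_nat_set_iff_bounded_le)
  have "finite P \<and> card P \<le> 2 * Polynomial.degree g + 1"
    \<comment> \<open>Here \<open>N\<close> and the 1 exclude roots, \<open>nat S\<close> gives
      \<open>S \<le> 2 ^ n\<close>, and \<open>k\<close> gives \<open>n + j \<le> 2 * n\<close>. The
      1 also makes \<open>n\<close> positive, so that it can be cancelled from the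
      exponents.\<close>
    if n: "n \<ge> N + nat S + k + 1" and j: "j \<le> k"
      and P: "P = {p. prime p \<and> 2 ^ n \<le> p \<and> int p dvd poly g (2 ^ (n + j))}" for n j P
  proof -
    define z where "z = nat \<bar>poly g (2 ^ (n + j))\<bar>"
    have z0: "z > 0" using N[of "n + j"] n by (auto simp: z_def)
    have dvd: "int p dvd poly g (2 ^ (n + j)) \<longleftrightarrow> p dvd z" for p
      by (simp add: z_def int_dvd_int_iff[symmetric])
    have fin: "finite P" and le: "(2 ^ n) ^ card P \<le> z"
      by (rule power_card_prime_divisors_le[OF z0, of P "2 ^ n"]; simp add: P dvd)+
    have "nat S < 2 ^ nat S" by (rule less_exp)
    also have "(2::nat) ^ nat S \<le> 2 ^ n" by (rule power_increasing) (use n in auto)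
    finally have "S \<le> 2 ^ n" by (simp add: nat_less_iff) 
    moreover have "int z \<le> S * (2 ^ (n + j)) ^ Polynomial.degree g"
      unfolding z_def S_def using abs_poly_le[of "2 ^ (n + j)" g] by simp
    moreover have "(2::int) ^ (n + j) \<le> 2 ^ (2 * n)" by (rule power_increasing) (use n j in auto)
    ultimately have "int z \<le> 2 ^ n * (2 ^ (2 * n)) ^ Polynomial.degree g"
      by (elim order.trans) (auto intro!: mult_mono power_mono)
    also have "\<dots> = int (2 ^ (n * (2 * Polynomial.degree g + 1)))"
      by (simp add: power_add power_mult[symmetric] algebra_simps)
    finally have "z \<le> 2 ^ (n * (2 * Polynomial.degree g + 1))" by (simp only: of_nat_le_iff)
    with le have "(2::nat) ^ (n * card P) \<le> 2 ^ (n * (2 * Polynomial.degree g + 1))"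
      by (simp add: power_mult)
    then have "n * card P \<le> n * (2 * Polynomial.degree g + 1)"
      by (rule power_le_imp_le_exp[rotated]) simp
    moreover have "0 < n" using n by simp
    ultimately have "card P \<le> 2 * Polynomial.degree g + 1" by (simp only: nat_mult_le_cancel1)
    with fin show ?thesis ..
  qed
  then show ?thesis by blast
qed

section \<open>An algebraic relation bounds the primes in dyadic intervals\<close>

theorem theorem1p1:
  fixes R' :: "nat \<Rightarrow> nat"
  assumes "\<exists>k::nat. k > 0 \<and>
    finite {p. prime p \<and>
      \<not> (\<exists>R::nat. (\<exists>n::nat. R = 2 ^ n) \<and>
            2 powi (- int k) * real R \<le> real p \<and> p < R \<and>
            [R' p * R = 1] (mod p))}"
  shows "transcendental_A (image_A (\<lambda>p. int (R' p)))"
proof -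
  have False if F: "F \<noteq> 0" "eval_A F (image_A (\<lambda>p. int (R' p))) = \<zero>\<^bsub>\<A>\<^esub>" for F
  proof -
    obtain k where fin1: "finite {p. prime p \<and>
      \<not> (\<exists>R::nat. (\<exists>n::nat. R = 2 ^ n) \<and>
            2 powi (- int k) * real R \<le> real p \<and> p < R \<and>
            [R' p * R = 1] (mod p))}" (is "finite ?E1")
      using assms by blast
    obtain d f where d: "d \<noteq> 0" and f: "Polynomial.smult (of_int d) F = map_poly of_int f"
      by (rule clear_denominators)
    have f0: "f \<noteq> 0" using f d F(1) by auto
    have fin2: "finite {p \<in> primes. \<not> [poly f (int (R' p)) = 0] (mod int p)}" (is "finite ?E2")
      by (rule eval_A_eq_zeroD[OF f d F(2)])
    define g where "g = reflect_poly f"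
    have "g \<noteq> 0" using f0 by (simp add: g_def)
    let ?P = "\<lambda>n j. {p. prime p \<and> 2 ^ n \<le> p \<and> int p dvd poly g (2 ^ (n + j))}"
    let ?c = "2 * Polynomial.degree g + 1"
    obtain N where N: "\<And>n j. n \<ge> N \<Longrightarrow> j \<le> k \<Longrightarrow> finite (?P n j) \<and> card (?P n j) \<le> ?c"
      using eventually_card_prime_divisors_le[OF \<open>g \<noteq> 0\<close>, of k] by blast
    have "finite (?E1 \<union> ?E2)" using fin1 fin2 by (rule finite_UnI)
    \<comment> \<open>Because \<open>b \<le> n < 2 ^ n\<close>, no prime of the \<open>n\<close>-th
      dyadic interval is exceptional once \<open>n \<ge> b\<close>.\<close>
    then obtain b where b: "\<forall>p\<in>?E1 \<union> ?E2. p \<le> b"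
      unfolding finite_nat_set_iff_bounded_le by (rule exE)
    have "dyadic_primes n \<subseteq> (\<Union>j\<in>{1..k}. ?P n j)" if n: "n \<ge> b" for n
    proof
      fix p assume "p \<in> dyadic_primes n"
      then have p: "prime p" "2 ^ n \<le> p" "p < 2 ^ (n + 1)" by (auto simp: dyadic_primes_def)
      have "b < p" using less_exp[of n] n p(2) by linarith
      then have "p \<notin> ?E1 \<union> ?E2" using bspec[OF b, of p] by linarith
      then obtain e where e: "2 powi (- int k) * real (2 ^ e) \<le> real p" "p < 2 ^ e"
          "[R' p * 2 ^ e = 1] (mod p)" and root: "[poly f (int (R' p)) = 0] (mod int p)"
        using p(1) by blast
      \<comment> \<open>The two bounds on \<open>R = 2 ^ e\<close> locate its exponent:
        \<open>2 ^ e \<le> 2 ^ k * p < 2 ^ (k + n + 1)\<close> gives \<open>e \<le> n + k\<close>,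
        and \<open>2 ^ n \<le> p < 2 ^ e\<close> gives \<open>e > n\<close>. Hence the shift
        \<open>e - n\<close> lies in \<open>{1..k}\<close>.\<close>
      have "real (2 ^ e) \<le> real (2 ^ k * p)"
        using e(1) by (simp add: power_int_minus field_simps)
      then have "(2::nat) ^ e \<le> 2 ^ k * p" by (simp only: of_nat_le_iff)
      also have "\<dots> < 2 ^ k * 2 ^ (n + 1)" using p(3) by simp
      finally have "(2::nat) ^ e < 2 ^ (k + (n + 1))" by (simp only: power_add)
      then have ek: "e < k + (n + 1)" by (rule power_less_imp_less_exp[rotated]) simp
      have "(2::nat) ^ n < 2 ^ e" using p(2) e(2) by linarith
      then have en: "n < e" by (rule power_less_imp_less_exp[rotated]) simp
      have "[int (R' p) * 2 ^ e = 1] (mod int p)"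
        using e(3) by (simp flip: cong_int_iff)
      \<comment> \<open>The inverse of \<open>R' p\<close> modulo \<open>p\<close> is
        \<open>2 ^ e\<close>, so the root \<open>R' p\<close> of \<open>f\<close> turns into the
        root \<open>2 ^ e\<close> of \<open>g\<close>.\<close>
      then have "[poly g (2 ^ e) = (2 ^ e) ^ Polynomial.degree f * poly f (int (R' p))] (mod int p)"
        unfolding g_def by (rule cong_poly_reflect_poly)
      moreover have "[(2 ^ e) ^ Polynomial.degree f * poly f (int (R' p)) =
          (2 ^ e) ^ Polynomial.degree f * 0] (mod int p)"
        by (intro cong_mult cong_refl root)
      ultimately have "[poly g (2 ^ e) = 0] (mod int p)"
        using cong_trans by fastforce
      then have "int p dvd poly g (2 ^ (n + (e - n)))"
        using en by (simp add: cong_0_iff)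
      then have "p \<in> ?P n (e - n)" "e - n \<in> {1..k}" using p ek en by auto
      then show "p \<in> (\<Union>j\<in>{1..k}. ?P n j)" by blast
    qed
    moreover have "card (\<Union>j\<in>{1..k}. ?P n j) \<le> k * ?c" and "finite (\<Union>j\<in>{1..k}. ?P n j)"
      if "n \<ge> N" for n
    proof -
      have "card (\<Union>j\<in>{1..k}. ?P n j) \<le> (\<Sum>j\<in>{1..k}. card (?P n j))"
        by (rule card_UN_le) simp
      also have "\<dots> \<le> (\<Sum>j\<in>{1..k}. ?c)"
        by (rule sum_mono) (use N that in auto)
      finally show "card (\<Union>j\<in>{1..k}. ?P n j) \<le> k * ?c" by simp
      show "finite (\<Union>j\<in>{1..k}. ?P n j)" using N that by auto
    qed
    ultimately have "card (dyadic_primes n) \<le> k * ?c" if "n \<ge> N + b" for n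
      using that by (meson card_mono le_trans add_leD1 add_leD2)
    then show False
      using card_dyadic_primes_unbounded[of "N + b" "k * ?c"] by (meson not_le)
  qed
  then show ?thesis by (auto simp: transcendental_A_def)
qed

end
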